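(* Let $p\in(\vec{p}_c,1)$. Under the definition of "$\asymp$" there is only one infinite oriented cluster; that is, $\mathbb{P}_p$-almost surely, $C_{u_1}\asymp C_{u_2}$ for any two percolation points $u_1,u_2\in\mathcal{K}$.
   Context: Oriented percolation. Let $\mathcal{L}=\{(m,n)\in\mathbb{Z}^2: m+n \text{ is even}\}$, with oriented edges from $(m,n)$ to $(m+1,n+1)$ and to $(m-1,n+1)$. Each edge is independently open with probability $p$ and closed with probability $1-p$; $\mathbb{P}_p$ is the product measure. For $u,v\in\mathcal{L}$ write $u\to v$ if there is a (possibly trivial) oriented path of open edges from $u$ to $v$. The oriented percolation cluster at $u$ is $C_u=\{v\in\mathcal{L}:u\to v\}$. Let $\theta(p)=\mathbb{P}_p(|C_{(0,0)}|=\infty)$ and $\vec{p}_c=\sup\{p:\theta(p)=0\}$; it is known that $0<\vec{p}_c<1$. A vertex $u$ is a percolation point if $|C_u|=\infty$, and $\mathcal{K}=\{u\in\mathcal{L}:|C_u|=\infty\}$. For two percolation points $u_1,u_2$, write $C_{u_1}\asymp C_{u_2}$ if $C_{u_1}=C_{u_2}$ except for finitely many vertices, i.e. if the symmetric difference of $C_{u_1}$ and $C_{u_2}$ is finite. *)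

theory Defs
  imports "HOL-Probability.Probability"
begin

type_synonym vertex = "int \<times> int"
type_synonym edge = "vertex \<times> vertex"

definition lattice_L :: "vertex set" where
  "lattice_L = {(m, n). even (m + n)}"

definition edges_L :: "edge set" where
  "edges_L = {((m, n), v) | m n v. (m, n) \<in> lattice_L \<and> v \<in> {(m + 1, n + 1), (m - 1, n + 1)}}"

text \<open>A configuration assigns \<open>True\<close> to the open edges and \<open>False\<close> to the closed ones.\<close>

definition perc_measure :: "real \<Rightarrow> (edge \<Rightarrow> bool) measure" where
  "perc_measure p = Pi\<^sub>M edges_L (\<lambda>_. measure_pmf (bernoulli_pmf p))"

definition open_edges :: "(edge \<Rightarrow> bool) \<Rightarrow> edge set" where
  "open_edges \<omega> = {e \<in> edges_L. \<omega> e}"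

definition connected_to :: "(edge \<Rightarrow> bool) \<Rightarrow> vertex \<Rightarrow> vertex \<Rightarrow> bool" where
  "connected_to \<omega> u v \<longleftrightarrow> (u, v) \<in> (open_edges \<omega>)\<^sup>*"

definition cluster :: "(edge \<Rightarrow> bool) \<Rightarrow> vertex \<Rightarrow> vertex set" where
  "cluster \<omega> u = {v \<in> lattice_L. connected_to \<omega> u v}"

definition percolation_points :: "(edge \<Rightarrow> bool) \<Rightarrow> vertex set" where
  "percolation_points \<omega> = {u \<in> lattice_L. infinite (cluster \<omega> u)}"

definition theta :: "real \<Rightarrow> real" where
  "theta p = measure (perc_measure p) {\<omega> \<in> space (perc_measure p). infinite (cluster \<omega> (0, 0))}"

text \<open>The range \<open>0 \<le> p \<le> 1\<close> is made explicit because \<open>bernoulli_pmf\<close> is total on the reals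
  (it clamps its argument to the unit interval), so that the supremum would otherwise also
  range over values that are not probabilities.\<close>

definition p_crit :: real where
  "p_crit = Sup {p. 0 \<le> p \<and> p \<le> 1 \<and> theta p = 0}"

definition almost_equal :: "vertex set \<Rightarrow> vertex set \<Rightarrow> bool" (infix "\<asymp>" 50) where
  "A \<asymp> B \<longleftrightarrow> finite (sym_diff A B)"

end

theory Submission imports Defs begin

text \<open>
  Every percolation point has an open edge to a percolation point one level higher, so stepping
  to the upper right whenever that edge is open and its end percolates, and to the upper left
  otherwise, traces an infinite open path: the rightmost one. Such a step changes the horizontal
  coordinate by one, and distinct vertices on one level are at least two apart, so
  rightmost paths never change their order, and two of them that meet agree from then on.

  If the rightmost paths of \<open>a\<close> and \<open>b\<close> meet, with \<open>a\<close> to the left of \<open>b\<close> on the same level, then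
  only finitely many vertices are reached from \<open>b\<close> but not from \<open>a\<close>: an infinite open path from \<open>b\<close>
  that avoids the cluster of \<open>a\<close> would be squeezed between the two rightmost paths
  (\<open>finite_cluster_diff_if_coalesce\<close>). Reflection gives the opposite difference, and percolation
  points on different levels are compared through descendants on a common level
  (\<open>finite_cluster_diff_if_same_level\<close>). It remains to show that almost surely any two rightmost
  paths that pass through a common level meet (\<open>AE_coalesce\<close>).

  This is a counting argument in the manner of Burton and Keane. Call a percolation point an
  isolated source if both edges into it are closed and its rightmost path meets no rightmost
  path started elsewhere on its level. Rightmost paths of distinct isolated sources are
  disjoint, even across levels: the lower path enters the level of the upper source at a
  different vertex. If isolated sources had positive density, then an \<open>N\<close> by \<open>N\<close> box would contain
  of order \<open>N\<^sup>2\<close> of them on average, while their disjoint paths have only of order \<open>N\<close> places to leave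
  the box; so there is almost surely no isolated source (\<open>AE_not_isolated_source\<close>).

  Since \<open>p < 1\<close>, closing finitely many edges preserves almost sure events. Suppose that, on some level,
  the rightmost path of a percolation point met neither that of some point to its left nor that
  of some point to its right. Then closing the edges out of
  the finitely many other vertices in between and the two edges into its starting point would
  produce an isolated source, so this almost surely does not happen
  (\<open>AE_no_noncoalescing_triple\<close>). Finally, if two rightmost paths failed to meet with positive
  probability, then so would, simultaneously, two horizontal translates of that pair, and these
  would contain three pairwise disjoint rightmost paths.
\<close>

section \<open>Clusters\<close>

definition up_right :: "vertex \<Rightarrow> vertex" where
  "up_right u = (fst u + 1, snd u + 1)"

definition up_left :: "vertex \<Rightarrow> vertex" where
  "up_left u = (fst u - 1, snd u + 1)"

lemma edges_L_iff: "(u, v) \<in> edges_L \<longleftrightarrow> u \<in> lattice_L \<and> (v = up_right u \<or> v = up_left u)"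
  by (cases u) (auto simp: edges_L_def up_right_def up_left_def)

lemma edges_L_lattice:
  assumes "(u, v) \<in> edges_L" shows "u \<in> lattice_L" "v \<in> lattice_L"
  using assms by (auto simp: edges_L_def lattice_L_def)

lemma open_edges_iff: "(u, v) \<in> open_edges \<omega> \<longleftrightarrow> (u, v) \<in> edges_L \<and> \<omega> (u, v)"
  by (simp add: open_edges_def)

lemma open_edgeD:
  assumes "(u, v) \<in> open_edges \<omega>"
  shows "u \<in> lattice_L" "v \<in> lattice_L" "v = up_right u \<or> v = up_left u" "snd v = snd u + 1"
proof -
  have e: "(u, v) \<in> edges_L" using assms by (simp add: open_edges_iff)
  show "u \<in> lattice_L" "v \<in> lattice_L" using edges_L_lattice[OF e] .
  show v: "v = up_right u \<or> v = up_left u" using e by (simp add: edges_L_iff)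
  then show "snd v = snd u + 1" by (auto simp: up_right_def up_left_def)
qed

lemma rtrancl_lattice: "(u, v) \<in> (open_edges \<omega>)\<^sup>* \<Longrightarrow> u \<in> lattice_L \<Longrightarrow> v \<in> lattice_L"
  by (induction rule: rtrancl_induct) (auto dest: open_edgeD(2))

lemma cluster_eq: "u \<in> lattice_L \<Longrightarrow> cluster \<omega> u = (open_edges \<omega>)\<^sup>* `` {u}"
  by (auto simp: cluster_def connected_to_def intro: rtrancl_lattice)

lemma cluster_self: "u \<in> lattice_L \<Longrightarrow> u \<in> cluster \<omega> u"
  by (simp add: cluster_eq)

lemma cluster_subset: "v \<in> cluster \<omega> u \<Longrightarrow> cluster \<omega> v \<subseteq> cluster \<omega> u"
  by (auto simp: cluster_def connected_to_def intro: rtrancl_trans)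

lemma cluster_step:
  "v \<in> cluster \<omega> u \<Longrightarrow> (v, w) \<in> open_edges \<omega> \<Longrightarrow> w \<in> cluster \<omega> u"
  by (auto simp: cluster_def connected_to_def dest: open_edgeD)

lemma cluster_unfold:
  assumes "u \<in> lattice_L"
  shows "cluster \<omega> u = insert u (\<Union>v\<in>{v. (u, v) \<in> open_edges \<omega>}. cluster \<omega> v)"
proof -
  have "(open_edges \<omega>)\<^sup>* `` {u} = insert u (\<Union>v\<in>{v. (u, v) \<in> open_edges \<omega>}. (open_edges \<omega>)\<^sup>* `` {v})"
    by (subst rtrancl_unfold, subst r_comp_rtrancl_eq[symmetric]) auto
  also have "\<dots> = insert u (\<Union>v\<in>{v. (u, v) \<in> open_edges \<omega>}. cluster \<omega> v)"
    using cluster_eq[OF open_edgeD(2)] by simp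
  finally show ?thesis using assms by (simp add: cluster_eq)
qed

text \<open>
  The inductive step of Koenig's lemma. With empty \<open>X\<close> it builds infinite open paths from
  percolation points; when \<open>X\<close> is a cluster, it builds infinite open paths that avoid \<open>X\<close>.
\<close>
lemma infinite_cluster_minus_child:
  assumes "u \<in> lattice_L" "infinite (cluster \<omega> u - X)"
  obtains v where "(u, v) \<in> open_edges \<omega>" "infinite (cluster \<omega> v - X)"
proof -
  let ?V = "{v. (u, v) \<in> open_edges \<omega>}"
  have "?V \<subseteq> {up_right u, up_left u}"
    by (auto dest: open_edgeD)
  then have "finite ?V" by (rule finite_subset) simp
  moreover have "cluster \<omega> u - X \<subseteq> insert u (\<Union>v\<in>?V. cluster \<omega> v - X)"
    using cluster_unfold[OF assms(1), of \<omega>] by blast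
  ultimately have "\<exists>v\<in>?V. infinite (cluster \<omega> v - X)"
    using assms(2) by (meson finite_UN finite_insert finite_subset)
  then show thesis using that by blast
qed

lemma infinite_cluster_minus_descendant:
  assumes "u \<in> lattice_L" "infinite (cluster \<omega> u - X)"
  shows "\<exists>v\<in>cluster \<omega> u. snd v = snd u + int k \<and> infinite (cluster \<omega> v - X)"
proof (induction k)
  case 0
  then show ?case using assms by (auto intro: cluster_self)
next
  case (Suc k)
  then obtain v where v: "v \<in> cluster \<omega> u" "snd v = snd u + int k" "infinite (cluster \<omega> v - X)"
    by blast
  then have "v \<in> lattice_L" by (simp add: cluster_def)
  then obtain w where w: "(v, w) \<in> open_edges \<omega>" "infinite (cluster \<omega> w - X)"
    using infinite_cluster_minus_child v(3) by metis
  then show ?case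
    using v by (intro bexI[of _ w]) (auto dest: open_edgeD intro: cluster_step)
qed

text \<open>
  A set \<open>S\<close> closed under upward edges contains the whole future of each of its vertices, so
  modifying a configuration on edges that start outside \<open>S\<close> changes nothing seen from \<open>S\<close>.
\<close>
lemma cluster_cong_on:
  assumes up: "\<And>s t. s \<in> S \<Longrightarrow> (s, t) \<in> edges_L \<Longrightarrow> t \<in> S"
    and eq: "\<And>s t. s \<in> S \<Longrightarrow> (s, t) \<in> edges_L \<Longrightarrow> \<omega> (s, t) = \<omega>' (s, t)"
    and u: "u \<in> S"
  shows "cluster \<omega> u = cluster \<omega>' u"
proof -
  have *: "(u, v) \<in> (open_edges \<beta>)\<^sup>* \<and> v \<in> S"
    if "(u, v) \<in> (open_edges \<alpha>)\<^sup>*"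
      "\<And>s t. s \<in> S \<Longrightarrow> (s, t) \<in> edges_L \<Longrightarrow> \<alpha> (s, t) = \<beta> (s, t)" for \<alpha> \<beta> v
    using that(1)
  proof (induction rule: rtrancl_induct)
    case base
    then show ?case using u by simp
  next
    case (step y z)
    have e: "(y, z) \<in> edges_L" "\<alpha> (y, z)" "y \<in> S"
      using step by (simp_all add: open_edges_iff)
    then have "(y, z) \<in> open_edges \<beta>"
      using that(2)[OF e(3,1)] by (simp add: open_edges_iff)
    then show ?case
      using step.IH up[OF e(3,1)] by (auto intro: rtrancl_into_rtrancl)
  qed
  show ?thesis
    unfolding cluster_def connected_to_def using *[where \<alpha> = \<omega> and \<beta> = \<omega>'] *[where \<alpha> = \<omega>' and \<beta> = \<omega>] eq
    by (metis (lifting))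
qed

section \<open>Rightmost infinite paths\<close>

text \<open>
  At a percolation point this is the first step of the rightmost infinite open path: whenever
  the edge to the upper right cannot be continued forever, the edge to the upper left can.
\<close>
definition right_step :: "(edge \<Rightarrow> bool) \<Rightarrow> vertex \<Rightarrow> vertex" where
  "right_step \<omega> u =
    (if (u, up_right u) \<in> open_edges \<omega> \<and> up_right u \<in> percolation_points \<omega>
     then up_right u else up_left u)"

abbreviation right_path :: "(edge \<Rightarrow> bool) \<Rightarrow> nat \<Rightarrow> vertex \<Rightarrow> vertex" where
  "right_path \<omega> n \<equiv> right_step \<omega> ^^ n"

text \<open>
  The paths are compared after equally many steps, which detects every meeting of paths that
  start on the same level; on different levels the relation never holds.
\<close>
definition coalesce :: "(edge \<Rightarrow> bool) \<Rightarrow> vertex \<Rightarrow> vertex \<Rightarrow> bool" where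
  "coalesce \<omega> u v \<longleftrightarrow> (\<exists>n. right_path \<omega> n u = right_path \<omega> n v)"

lemma right_step_percolates:
  assumes "u \<in> percolation_points \<omega>"
  shows "right_step \<omega> u \<in> percolation_points \<omega>" "(u, right_step \<omega> u) \<in> open_edges \<omega>"
proof -
  have "u \<in> lattice_L" "infinite (cluster \<omega> u - {})"
    using assms by (auto simp: percolation_points_def)
  then obtain v where v: "(u, v) \<in> open_edges \<omega>" "infinite (cluster \<omega> v - {})"
    by (rule infinite_cluster_minus_child)
  then have "v \<in> percolation_points \<omega>" "v = up_right u \<or> v = up_left u"
    by (auto simp: percolation_points_def dest: open_edgeD)
  then show "right_step \<omega> u \<in> percolation_points \<omega>" "(u, right_step \<omega> u) \<in> open_edges \<omega>"
    using v(1) by (auto simp: right_step_def)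
qed

lemma right_path_percolates:
  "u \<in> percolation_points \<omega> \<Longrightarrow> right_path \<omega> n u \<in> percolation_points \<omega>"
  by (induction n) (auto intro: right_step_percolates)

lemma right_path_in_cluster:
  "u \<in> percolation_points \<omega> \<Longrightarrow> right_path \<omega> n u \<in> cluster \<omega> u"
proof (induction n)
  case 0
  then show ?case by (auto simp: percolation_points_def intro: cluster_self)
next
  case (Suc n)
  have "(right_path \<omega> n u, right_path \<omega> (Suc n) u) \<in> open_edges \<omega>"
    using right_step_percolates(2)[OF right_path_percolates[OF Suc.prems]] by simp
  with Suc.IH[OF Suc.prems] show ?case by (rule cluster_step)
qed

lemma snd_right_path: "snd (right_path \<omega> n u) = snd u + int n"
  by (induction n) (auto simp: right_step_def up_left_def up_right_def)

lemma fst_right_path: "\<bar>fst (right_path \<omega> n u) - fst u\<bar> \<le> int n"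
  by (induction n) (auto simp: right_step_def up_left_def up_right_def)

lemma right_step_lattice: "right_step \<omega> u \<in> lattice_L \<longleftrightarrow> u \<in> lattice_L"
  by (cases u) (auto simp: right_step_def up_left_def up_right_def lattice_L_def)

lemma right_path_lattice: "right_path \<omega> n u \<in> lattice_L \<longleftrightarrow> u \<in> lattice_L"
  by (induction n) (auto simp: right_step_lattice)

lemma lattice_gap:
  assumes "u \<in> lattice_L" "v \<in> lattice_L" "snd u = snd v" "fst u < fst v"
  shows "fst u + 2 \<le> fst v"
proof -
  obtain a b c where uv: "u = (a, c)" "v = (b, c)"
    using assms(3) by (metis prod.collapse)
  have "even (a + c)" "even (b + c)" "a < b"
    using assms uv by (auto simp: lattice_L_def)
  then have "a + 2 \<le> b" by presburger
  then show ?thesis by (simp add: uv)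
qed

text \<open>
  Order is preserved even though \<open>u\<close> may move right and \<open>v\<close> left: by parity they are at least two
  apart unless they coincide.
\<close>
lemma right_step_mono:
  assumes "u \<in> lattice_L" "v \<in> lattice_L" "snd u = snd v" "fst u \<le> fst v"
  shows "fst (right_step \<omega> u) \<le> fst (right_step \<omega> v)"
proof (cases "fst u = fst v")
  case True
  then have "u = v" using assms by (simp add: prod_eq_iff)
  then show ?thesis by simp
next
  case False
  then have "fst u + 2 \<le> fst v" using lattice_gap[OF assms(1-3)] assms(4) by simp
  then show ?thesis by (auto simp: right_step_def up_left_def up_right_def)
qed

lemma right_path_mono:
  assumes "u \<in> lattice_L" "v \<in> lattice_L" "snd u = snd v" "fst u \<le> fst v"
  shows "fst (right_path \<omega> n u) \<le> fst (right_path \<omega> n v)"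
proof (induction n)
  case 0
  then show ?case using assms by simp
next
  case (Suc n)
  then show ?case
    using assms by (auto intro!: right_step_mono simp: right_path_lattice snd_right_path)
qed

lemma coalesce_between:
  assumes "u \<in> lattice_L" "v \<in> lattice_L" "w \<in> lattice_L"
    and "snd u = snd v" "snd v = snd w" "fst u \<le> fst v" "fst v \<le> fst w" "coalesce \<omega> u w"
  shows "coalesce \<omega> u v" "coalesce \<omega> v w"
proof -
  obtain n where n: "right_path \<omega> n u = right_path \<omega> n w"
    using assms(8) by (auto simp: coalesce_def)
  have "fst (right_path \<omega> n v) = fst (right_path \<omega> n u)"
    using right_path_mono[of u v n \<omega>] right_path_mono[of v w n \<omega>] n assms by simp
  then have "right_path \<omega> n v = right_path \<omega> n u"
    using assms(4) by (simp add: prod_eq_iff snd_right_path)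
  then show "coalesce \<omega> u v" "coalesce \<omega> v w"
    using n by (auto simp: coalesce_def intro: exI[of _ n])
qed

text \<open>
  If infinitely many vertices were reached from \<open>b\<close> but not from \<open>a\<close>, then some infinite open path
  from \<open>b\<close> would avoid the cluster of \<open>a\<close>. It lies weakly to the left of the rightmost path of \<open>b\<close>,
  and strictly to the right of the rightmost path of \<open>a\<close>, which it cannot cross without hitting it.
  So these two rightmost paths never meet. The induction follows such a path level by level.
\<close>
lemma finite_cluster_diff_if_coalesce:
  assumes ab: "a \<in> percolation_points \<omega>" "b \<in> percolation_points \<omega>"
    and lt: "snd a = snd b" "fst a < fst b"
    and coal: "coalesce \<omega> a b"
  shows "finite (cluster \<omega> b - cluster \<omega> a)"
proof (rule ccontr)
  assume inf: "infinite (cluster \<omega> b - cluster \<omega> a)"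
  have *: "\<exists>w\<in>lattice_L. snd w = snd b + int n \<and> infinite (cluster \<omega> w - cluster \<omega> a) \<and>
      fst (right_path \<omega> n a) < fst w \<and> fst w \<le> fst (right_path \<omega> n b)" for n
  proof (induction n)
    case 0
    then show ?case using inf lt ab by (auto simp: percolation_points_def)
  next
    case (Suc n)
    then obtain w where w: "w \<in> lattice_L" "snd w = snd b + int n"
      "infinite (cluster \<omega> w - cluster \<omega> a)"
      "fst (right_path \<omega> n a) < fst w" "fst w \<le> fst (right_path \<omega> n b)" by blast
    obtain v where v: "(w, v) \<in> open_edges \<omega>" "infinite (cluster \<omega> v - cluster \<omega> a)"
      using infinite_cluster_minus_child w(1,3) by metis
    have vL: "v \<in> lattice_L" "snd v = snd b + int (Suc n)"
      using open_edgeD[OF v(1)] w(2) by auto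
    have pL: "right_path \<omega> k a \<in> lattice_L" "right_path \<omega> k b \<in> lattice_L" for k
      using ab by (auto simp: right_path_lattice percolation_points_def)
    have "v \<notin> cluster \<omega> a"
      using v(2) cluster_subset by (metis Diff_eq_empty_iff finite.emptyI)
    then have ne: "v \<noteq> right_path \<omega> (Suc n) a"
      using right_path_in_cluster[OF ab(1)] by metis
    have "fst (right_path \<omega> n a) + 2 \<le> fst w"
      using lattice_gap[OF pL(1) w(1)] w lt by (simp add: snd_right_path)
    then have "fst (right_path \<omega> (Suc n) a) \<le> fst v"
      using open_edgeD(3)[OF v(1)] by (auto simp: right_step_def up_left_def up_right_def)
    then have 1: "fst (right_path \<omega> (Suc n) a) < fst v"
      using ne vL(2) lt(1) snd_right_path[of "Suc n" \<omega> a] by (auto simp: prod_eq_iff order_less_le)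
    have 2: "fst v \<le> fst (right_path \<omega> (Suc n) b)"
    proof (cases "w = right_path \<omega> n b")
      case True
      have "v \<in> percolation_points \<omega>"
        using v(2) vL(1) by (auto simp: percolation_points_def)
      then show ?thesis
        using True v(1) open_edgeD(3)[OF v(1)]
        by (auto simp: right_step_def up_left_def up_right_def)
    next
      case False
      then have "fst w < fst (right_path \<omega> n b)"
        using w(2,5) snd_right_path[of n \<omega> b] by (auto simp: prod_eq_iff order_less_le)
      then have "fst w + 2 \<le> fst (right_path \<omega> n b)"
        using lattice_gap[OF w(1) pL(2)] w(2) by (simp add: snd_right_path)
      then show ?thesis
        using open_edgeD(3)[OF v(1)] by (auto simp: right_step_def up_left_def up_right_def)
    qed
    show ?case using 1 2 v(2) vL by blast
  qed
  from coal obtain n where "right_path \<omega> n a = right_path \<omega> n b"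
    by (auto simp: coalesce_def)
  then show False using *[of n] by auto
qed

section \<open>Isolated sources\<close>

definition isolated_source :: "(edge \<Rightarrow> bool) \<Rightarrow> vertex \<Rightarrow> bool" where
  "isolated_source \<omega> y \<longleftrightarrow> y \<in> percolation_points \<omega> \<and> (\<forall>v. (v, y) \<notin> open_edges \<omega>) \<and>
    (\<forall>v\<in>percolation_points \<omega>. snd v = snd y \<and> v \<noteq> y \<longrightarrow> \<not> coalesce \<omega> v y)"

text \<open>
  The rightmost path of the lower source reaches the level of the upper one at a percolation
  point other than the upper source, because no open edge ends there; isolation of
  the upper source on its own level then keeps the two paths apart.
\<close>
lemma isolated_source_paths_disjoint:
  assumes "isolated_source \<omega> u" "isolated_source \<omega> v" "u \<noteq> v"
    and "snd u + int i = snd v + int j"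
  shows "right_path \<omega> i u \<noteq> right_path \<omega> j v"
proof -
  have *: "right_path \<omega> i u \<noteq> right_path \<omega> j v"
    if uv: "isolated_source \<omega> u" "isolated_source \<omega> v" "u \<noteq> v"
      and ij: "snd u + int i = snd v + int j" and le: "snd u \<le> snd v" for u v i j
  proof -
    define d where "d = nat (snd v - snd u)"
    define w where "w = right_path \<omega> d u"
    have uP: "u \<in> percolation_points \<omega>"
      using uv(1) by (simp add: isolated_source_def)
    have w: "w \<in> percolation_points \<omega>" "snd w = snd v"
      using right_path_percolates[OF uP] le by (auto simp: w_def snd_right_path d_def)
    have "w \<noteq> v"
    proof (cases d)
      case 0
      then show ?thesis using uv(3) by (simp add: w_def)
    next
      case (Suc k)
      then have "(right_path \<omega> k u, w) \<in> open_edges \<omega>"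
        using right_step_percolates(2)[OF right_path_percolates[OF uP]] by (simp add: w_def)
      then show ?thesis using uv(2) unfolding isolated_source_def by metis
    qed
    then have "\<not> coalesce \<omega> w v"
      using uv(2) w by (auto simp: isolated_source_def)
    moreover have "i = j + d" using ij le by (simp add: d_def)
    then have "right_path \<omega> i u = right_path \<omega> j w"
      by (simp add: w_def funpow_add)
    ultimately show ?thesis by (auto simp: coalesce_def)
  qed
  show ?thesis
    using *[OF assms] *[OF assms(2,1) assms(3)[symmetric] assms(4)[symmetric]]
    by (cases "snd u \<le> snd v") auto
qed

lemma right_path_cong_on:
  assumes up: "\<And>s t. s \<in> S \<Longrightarrow> (s, t) \<in> edges_L \<Longrightarrow> t \<in> S"
    and eq: "\<And>s t. s \<in> S \<Longrightarrow> (s, t) \<in> edges_L \<Longrightarrow> \<omega> (s, t) = \<omega>' (s, t)"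
    and u: "u \<in> S" "u \<in> lattice_L"
  shows "right_path \<omega> n u = right_path \<omega>' n u"
proof -
  have perc: "v \<in> percolation_points \<omega> \<longleftrightarrow> v \<in> percolation_points \<omega>'" if "v \<in> S" for v
    using cluster_cong_on[of S \<omega> \<omega>', OF up eq that] by (simp add: percolation_points_def)
  have step: "right_step \<omega> v = right_step \<omega>' v \<and> right_step \<omega> v \<in> S"
    if "v \<in> S" "v \<in> lattice_L" for v
  proof -
    have "(v, up_right v) \<in> edges_L" "(v, up_left v) \<in> edges_L"
      using that(2) by (auto simp: edges_L_iff)
    then show ?thesis
      using up eq that(1) perc by (auto simp: right_step_def open_edges_iff)
  qed
  have "right_path \<omega> n u = right_path \<omega>' n u \<and> right_path \<omega> n u \<in> S"
  proof (induction n)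
    case 0
    then show ?case using u by simp
  next
    case (Suc n)
    then show ?case using step[of "right_path \<omega> n u"] u by (auto simp: right_path_lattice)
  qed
  then show ?thesis ..
qed

definition close_edges :: "edge set \<Rightarrow> (edge \<Rightarrow> bool) \<Rightarrow> edge \<Rightarrow> bool" where
  "close_edges A \<omega> = (\<lambda>e. if e \<in> A then False else \<omega> e)"

text \<open>
  Once the vertices strictly between \<open>x\<close> and \<open>z\<close> other than \<open>y\<close> have lost their outgoing edges, the
  only competitors of \<open>y\<close> on its level lie weakly to the left of \<open>x\<close> or weakly to the right of \<open>z\<close>,
  and order preservation keeps their rightmost paths away from that of \<open>y\<close>. The futures of
  \<open>x\<close>, \<open>y\<close>, \<open>z\<close> and of these competitors do not use any of the closed edges.
\<close>
lemma isolated_source_by_closing: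
  assumes xyz: "x \<in> percolation_points \<omega>" "y \<in> percolation_points \<omega>" "z \<in> percolation_points \<omega>"
    and level: "snd x = snd y" "snd z = snd y"
    and order: "fst x < fst y" "fst y < fst z"
    and not_coal: "\<not> coalesce \<omega> x y" "\<not> coalesce \<omega> y z"
  obtains A where "finite A" "A \<subseteq> edges_L" "isolated_source (close_edges A \<omega>) y"
proof -
  define V where "V = {v. snd v = snd y \<and> fst x < fst v \<and> fst v < fst z \<and> v \<noteq> y}"
  define A where "A = {(u, v) \<in> edges_L. u \<in> V \<or> v = y}"
  define \<omega>' where "\<omega>' = close_edges A \<omega>"
  define S where "S = {v. snd y \<le> snd v \<and> v \<notin> V}"
  have "V \<subseteq> {fst x..fst z} \<times> {snd y}"
    by (auto simp: V_def)
  then have "finite V" by (rule finite_subset) simp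
  have "A \<subseteq> (\<lambda>v. (v, up_right v)) ` V \<union> (\<lambda>v. (v, up_left v)) ` V \<union>
      {((fst y + 1, snd y - 1), y), ((fst y - 1, snd y - 1), y)}"
    by (auto simp: A_def edges_L_iff up_right_def up_left_def prod_eq_iff)
  then have "finite A" by (rule finite_subset) (use \<open>finite V\<close> in simp)
  moreover have "A \<subseteq> edges_L" by (auto simp: A_def)
  moreover have "isolated_source \<omega>' y"
  proof -
    have lat: "x \<in> lattice_L" "y \<in> lattice_L" "z \<in> lattice_L"
      using xyz by (auto simp: percolation_points_def)
    have up: "t \<in> S" if "s \<in> S" "(s, t) \<in> edges_L" for s t
      using that by (auto simp: S_def V_def edges_L_iff up_right_def up_left_def)
    have eq: "\<omega> (s, t) = \<omega>' (s, t)" if "s \<in> S" "(s, t) \<in> edges_L" for s t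
      using that by (auto simp: S_def A_def \<omega>'_def close_edges_def edges_L_iff up_right_def up_left_def)
    have S: "x \<in> S" "y \<in> S" "z \<in> S"
      using level by (auto simp: S_def V_def)
    have yP: "y \<in> percolation_points \<omega>'"
      using cluster_cong_on[of S \<omega> \<omega>', OF up eq S(2)] xyz(2) by (simp add: percolation_points_def)
    have path: "right_path \<omega> n w = right_path \<omega>' n w" if "w \<in> S" "w \<in> lattice_L" for n w
      by (rule right_path_cong_on[of S]) (use up eq that in blast)+
    have closed: "(v, y) \<notin> open_edges \<omega>'" for v
      by (auto simp: open_edges_def \<omega>'_def close_edges_def A_def)
    have "\<not> coalesce \<omega>' v y" if v: "v \<in> percolation_points \<omega>'" "snd v = snd y" "v \<noteq> y" for v
    proof -
      have vL: "v \<in> lattice_L" using v by (simp add: percolation_points_def)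
      have "v \<notin> V"
        using right_step_percolates(2)[OF v(1)]
        by (auto simp: open_edges_def \<omega>'_def close_edges_def A_def)
      then have "v \<in> S" using v(2) by (simp add: S_def)
      then have "coalesce \<omega>' v y \<longleftrightarrow> coalesce \<omega> v y"
        using path vL S(2) lat(2) by (simp add: coalesce_def)
      moreover have "\<not> coalesce \<omega> v y"
      proof
        assume c: "coalesce \<omega> v y"
        have "fst v \<le> fst x \<or> fst z \<le> fst v"
          using \<open>v \<notin> V\<close> v by (auto simp: V_def)
        then show False
        proof
          assume "fst v \<le> fst x"
          then show False
            using coalesce_between(2)[of v x y \<omega>] lat vL v(2) level order c not_coal by simp
        next
          assume "fst z \<le> fst v"
          moreover have "coalesce \<omega> y v"
            using c unfolding coalesce_def by metis
          ultimately show False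
            using coalesce_between(1)[of y z v \<omega>] lat vL v(2) level order not_coal by simp
        qed
      qed
      ultimately show ?thesis by simp
    qed
    then show ?thesis using yP closed by (auto simp: isolated_source_def)
  qed
  ultimately show thesis using that unfolding \<omega>'_def by blast
qed

section \<open>Symmetries\<close>

text \<open>
  The configuration \<open>\<omega>\<close> in the coordinates given by \<open>\<phi>\<close>, made undefined off the lattice
  so that it is again a point of the product space.
\<close>
definition pullback :: "(vertex \<Rightarrow> vertex) \<Rightarrow> (edge \<Rightarrow> bool) \<Rightarrow> edge \<Rightarrow> bool" where
  "pullback \<phi> \<omega> = (\<lambda>e\<in>edges_L. \<omega> (map_prod \<phi> \<phi> e))"

definition lattice_automorphism :: "(vertex \<Rightarrow> vertex) \<Rightarrow> bool" where
  "lattice_automorphism \<phi> \<longleftrightarrow> bij \<phi> \<and> (\<forall>u. \<phi> u \<in> lattice_L \<longleftrightarrow> u \<in> lattice_L) \<and>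
    (\<forall>u v. (\<phi> u, \<phi> v) \<in> edges_L \<longleftrightarrow> (u, v) \<in> edges_L)"

lemma lattice_automorphism_edge:
  assumes "lattice_automorphism \<phi>" "e \<in> edges_L"
  shows "map_prod \<phi> \<phi> e \<in> edges_L"
proof -
  obtain u v where e: "e = (u, v)" by (rule prod.exhaust)
  have "(\<phi> u, \<phi> v) \<in> edges_L"
    using assms e unfolding lattice_automorphism_def by blast
  then show ?thesis by (simp add: e)
qed

lemma open_edges_pullback:
  assumes "lattice_automorphism \<phi>"
  shows "(u, v) \<in> open_edges (pullback \<phi> \<omega>) \<longleftrightarrow> (\<phi> u, \<phi> v) \<in> open_edges \<omega>"
proof -
  have "(\<phi> u, \<phi> v) \<in> edges_L \<longleftrightarrow> (u, v) \<in> edges_L"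
    using assms unfolding lattice_automorphism_def by blast
  then show ?thesis by (simp add: open_edges_iff pullback_def)
qed

lemma cluster_pullback:
  assumes \<phi>: "lattice_automorphism \<phi>"
  shows "cluster (pullback \<phi> \<omega>) u = \<phi> -` cluster \<omega> (\<phi> u)"
proof -
  have bij: "bij \<phi>" using \<phi> by (simp add: lattice_automorphism_def)
  have inv: "inv \<phi> (\<phi> v) = v" "\<phi> (inv \<phi> v) = v" for v
    using bij by (simp_all add: bij_is_inj bij_is_surj surj_f_inv_f)
  have 1: "(\<phi> u, \<phi> v) \<in> (open_edges \<omega>)\<^sup>*" if "(u, v) \<in> (open_edges (pullback \<phi> \<omega>))\<^sup>*" for v
    using that
    by (induction rule: rtrancl_induct)
      (auto simp: open_edges_pullback[OF \<phi>] intro: rtrancl_into_rtrancl)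
  have 2: "(u, inv \<phi> v) \<in> (open_edges (pullback \<phi> \<omega>))\<^sup>*" if "(\<phi> u, v) \<in> (open_edges \<omega>)\<^sup>*" for v
    using that
    by (induction rule: rtrancl_induct)
      (auto simp: inv open_edges_pullback[OF \<phi>] intro: rtrancl_into_rtrancl)
  have "(u, v) \<in> (open_edges (pullback \<phi> \<omega>))\<^sup>* \<longleftrightarrow> (\<phi> u, \<phi> v) \<in> (open_edges \<omega>)\<^sup>*" for v
    using 1[of v] 2[of "\<phi> v"] by (auto simp: inv)
  moreover have "\<phi> v \<in> lattice_L \<longleftrightarrow> v \<in> lattice_L" for v
    using \<phi> unfolding lattice_automorphism_def by blast
  ultimately show ?thesis
    by (simp add: cluster_def connected_to_def vimage_def)
qed

lemma percolation_points_pullback: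
  assumes \<phi>: "lattice_automorphism \<phi>"
  shows "u \<in> percolation_points (pullback \<phi> \<omega>) \<longleftrightarrow> \<phi> u \<in> percolation_points \<omega>"
proof -
  have "bij \<phi>" using \<phi> by (simp add: lattice_automorphism_def)
  then have "finite (\<phi> -` cluster \<omega> (\<phi> u)) \<longleftrightarrow> finite (cluster \<omega> (\<phi> u))"
    by (rule finite_vimage_iff)
  moreover have "\<phi> u \<in> lattice_L \<longleftrightarrow> u \<in> lattice_L"
    using \<phi> unfolding lattice_automorphism_def by blast
  ultimately show ?thesis
    by (simp add: percolation_points_def cluster_pullback[OF \<phi>])
qed

definition reflect :: "vertex \<Rightarrow> vertex" where
  "reflect u = (- fst u, snd u)"

lemma lattice_automorphism_reflect: "lattice_automorphism reflect"
proof -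
  have "bij reflect"
    by (rule o_bij[of reflect]) (auto simp: reflect_def)
  moreover have "reflect u \<in> lattice_L \<longleftrightarrow> u \<in> lattice_L" for u
    by (cases u) (auto simp: reflect_def lattice_L_def)
  moreover from this have "(reflect u, reflect v) \<in> edges_L \<longleftrightarrow> (u, v) \<in> edges_L" for u v
    by (auto simp: edges_L_iff reflect_def up_right_def up_left_def prod_eq_iff)
  ultimately show ?thesis by (simp add: lattice_automorphism_def)
qed

definition translate :: "vertex \<Rightarrow> vertex \<Rightarrow> vertex" where
  "translate t u = (fst u + fst t, snd u + snd t)"

lemma lattice_automorphism_translate:
  assumes "t \<in> lattice_L"
  shows "lattice_automorphism (translate t)"
proof -
  have "bij (translate t)"
    by (rule o_bij[of "translate (- fst t, - snd t)"]) (auto simp: translate_def)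
  moreover have "translate t u \<in> lattice_L \<longleftrightarrow> u \<in> lattice_L" for u
    using assms by (cases u; cases t) (auto simp: translate_def lattice_L_def)
  moreover from this have "(translate t u, translate t v) \<in> edges_L \<longleftrightarrow> (u, v) \<in> edges_L" for u v
    by (auto simp: edges_L_iff translate_def up_right_def up_left_def prod_eq_iff)
  ultimately show ?thesis by (simp add: lattice_automorphism_def)
qed

lemma right_path_translate:
  assumes "t \<in> lattice_L"
  shows "translate t (right_path (pullback (translate t) \<omega>) n u) = right_path \<omega> n (translate t u)"
proof -
  have *: "translate t (right_step (pullback (translate t) \<omega>) u) = right_step \<omega> (translate t u)" for u
  proof -
    have "translate t (up_right u) = up_right (translate t u)" "translate t (up_left u) = up_left (translate t u)"
      by (auto simp: translate_def up_right_def up_left_def)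
    then show ?thesis
      by (simp add: right_step_def open_edges_pullback percolation_points_pullback
          lattice_automorphism_translate assms)
  qed
  show ?thesis by (induction n) (auto simp: *)
qed

lemma coalesce_translate:
  assumes "t \<in> lattice_L"
  shows "coalesce (pullback (translate t) \<omega>) u v \<longleftrightarrow> coalesce \<omega> (translate t u) (translate t v)"
proof -
  have "translate t a = translate t b \<longleftrightarrow> a = b" for a b
    by (auto simp: translate_def prod_eq_iff)
  then show ?thesis
    unfolding coalesce_def right_path_translate[OF assms, symmetric] by simp
qed

lemma isolated_source_translate:
  assumes "t \<in> lattice_L"
  shows "isolated_source (pullback (translate t) \<omega>) u \<longleftrightarrow> isolated_source \<omega> (translate t u)"
proof -
  note aut = lattice_automorphism_translate[OF assms]
  have surj: "surj (translate t)"
    using aut by (simp add: lattice_automorphism_def bij_is_surj)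
  have all: "(\<forall>v. P v) \<longleftrightarrow> (\<forall>v. P (translate t v))" for P
    using surj by (metis surjD)
  have "translate t a = translate t b \<longleftrightarrow> a = b" "snd (translate t a) = snd (translate t b) \<longleftrightarrow> snd a = snd b" for a b
    by (auto simp: translate_def prod_eq_iff)
  then have "(\<forall>v. v \<in> percolation_points (pullback (translate t) \<omega>) \<longrightarrow> snd v = snd u \<and> v \<noteq> u \<longrightarrow>
        \<not> coalesce (pullback (translate t) \<omega>) v u) \<longleftrightarrow>
      (\<forall>v. translate t v \<in> percolation_points \<omega> \<longrightarrow>
        snd (translate t v) = snd (translate t u) \<and> translate t v \<noteq> translate t u \<longrightarrow>
        \<not> coalesce \<omega> (translate t v) (translate t u))"
    by (simp add: percolation_points_pullback[OF aut] coalesce_translate[OF assms])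
  also have "\<dots> \<longleftrightarrow> (\<forall>v. v \<in> percolation_points \<omega> \<longrightarrow>
        snd v = snd (translate t u) \<and> v \<noteq> translate t u \<longrightarrow> \<not> coalesce \<omega> v (translate t u))"
    by (rule all[symmetric])
  finally have 1: "(\<forall>v\<in>percolation_points (pullback (translate t) \<omega>). snd v = snd u \<and> v \<noteq> u \<longrightarrow>
        \<not> coalesce (pullback (translate t) \<omega>) v u) \<longleftrightarrow> (\<forall>v\<in>percolation_points \<omega>.
        snd v = snd (translate t u) \<and> v \<noteq> translate t u \<longrightarrow> \<not> coalesce \<omega> v (translate t u))"
    by (simp only: Ball_def)
  have 2: "(\<forall>v. (v, u) \<notin> open_edges (pullback (translate t) \<omega>)) \<longleftrightarrow>
      (\<forall>v. (v, translate t u) \<notin> open_edges \<omega>)"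
    using all[of "\<lambda>v. (v, translate t u) \<notin> open_edges \<omega>"] by (simp add: open_edges_pullback[OF aut])
  show ?thesis
    unfolding isolated_source_def 1 2 by (simp add: percolation_points_pullback[OF aut])
qed

section \<open>The percolation measure\<close>

lemma prob_space_perc_measure: "prob_space (perc_measure p)"
  unfolding perc_measure_def by (intro prob_space_PiM measure_pmf.prob_space_axioms)

lemma pred_open_edges [measurable]: "Measurable.pred (perc_measure p) (\<lambda>\<omega>. (u, v) \<in> open_edges \<omega>)"
proof (cases "(u, v) \<in> edges_L")
  case True
  then have "(\<lambda>\<omega>. \<omega> (u, v)) \<in> measurable (perc_measure p) (measure_pmf (bernoulli_pmf p))"
    unfolding perc_measure_def by (rule measurable_component_singleton)
  then have "Measurable.pred (perc_measure p) (\<lambda>\<omega>. \<omega> (u, v))"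
    by simp
  then show ?thesis using True by (simp add: open_edges_iff)
next
  case False
  then show ?thesis by (simp add: open_edges_iff)
qed

lemma pred_cluster [measurable]: "Measurable.pred (perc_measure p) (\<lambda>\<omega>. v \<in> cluster \<omega> u)"
proof -
  have "Measurable.pred (perc_measure p) (\<lambda>\<omega>. (u, w) \<in> open_edges \<omega> ^^ n)" for n w
  proof (induction n arbitrary: w)
    case 0
    then show ?case by simp
  next
    case (Suc n)
    have "(u, w) \<in> open_edges \<omega> ^^ Suc n \<longleftrightarrow>
        (\<exists>z. (u, z) \<in> open_edges \<omega> ^^ n \<and> (z, w) \<in> open_edges \<omega>)" for \<omega>
      by auto
    then show ?case using Suc by simp
  qed
  then show ?thesis
    by (simp add: cluster_def connected_to_def rtrancl_power)
qed

lemma pred_percolation_points [measurable]: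
  "Measurable.pred (perc_measure p) (\<lambda>\<omega>. u \<in> percolation_points \<omega>)"
proof -
  have "infinite A \<longleftrightarrow> (\<forall>n. \<exists>v. v \<in> A \<and> n < to_nat v)" for A :: "vertex set"
  proof -
    have "infinite A \<longleftrightarrow> infinite (to_nat ` A)"
      by (simp add: finite_image_iff)
    also have "\<dots> \<longleftrightarrow> (\<forall>n. \<exists>v. v \<in> A \<and> n < to_nat v)"
      unfolding infinite_nat_iff_unbounded by blast
    finally show ?thesis .
  qed
  then show ?thesis by (simp add: percolation_points_def)
qed

lemma measurable_right_path [measurable]:
  "(\<lambda>\<omega>. right_path \<omega> n u) \<in> measurable (perc_measure p) (count_space UNIV)"
proof (induction n)
  case 0
  then show ?case by simp
next
  case (Suc n)
  have "(\<lambda>\<omega>. right_step \<omega> v) \<in> measurable (perc_measure p) (count_space UNIV)" for v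
    unfolding right_step_def by measurable
  from measurable_compose_countable[OF this Suc] show ?case by simp
qed

lemma pred_coalesce [measurable]: "Measurable.pred (perc_measure p) (\<lambda>\<omega>. coalesce \<omega> u v)"
proof -
  have "coalesce \<omega> u v \<longleftrightarrow> (\<exists>n w. right_path \<omega> n u = w \<and> right_path \<omega> n v = w)" for \<omega>
    unfolding coalesce_def by metis
  then show ?thesis by simp
qed

lemma pred_isolated_source [measurable]:
  "Measurable.pred (perc_measure p) (\<lambda>\<omega>. isolated_source \<omega> u)"
  unfolding isolated_source_def Ball_def by measurable

lemma measurable_pullback:
  assumes \<phi>: "lattice_automorphism \<phi>"
  shows "pullback \<phi> \<in> measurable (perc_measure p) (perc_measure p)"
  unfolding perc_measure_def pullback_def
proof (rule measurable_restrict)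
  fix e assume "e \<in> edges_L"
  then have "map_prod \<phi> \<phi> e \<in> edges_L"
    by (rule lattice_automorphism_edge[OF \<phi>])
  then show "(\<lambda>\<omega>. \<omega> (map_prod \<phi> \<phi> e)) \<in> measurable
      (Pi\<^sub>M edges_L (\<lambda>_. measure_pmf (bernoulli_pmf p))) (measure_pmf (bernoulli_pmf p))"
    by (rule measurable_component_singleton)
qed

lemma distr_pullback:
  assumes \<phi>: "lattice_automorphism \<phi>"
  shows "distr (perc_measure p) (perc_measure p) (pullback \<phi>) = perc_measure p"
proof -
  have "inj \<phi>" using \<phi> by (simp add: lattice_automorphism_def bij_is_inj)
  then have inj: "inj_on (map_prod \<phi> \<phi>) edges_L"
    by (intro inj_on_subset[OF prod.inj_map]) auto
  have sub: "map_prod \<phi> \<phi> \<in> edges_L \<rightarrow> edges_L"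
    using lattice_automorphism_edge[OF \<phi>] by blast
  show ?thesis
    unfolding perc_measure_def pullback_def
    by (rule distr_PiM_reindex[of edges_L "\<lambda>_. measure_pmf (bernoulli_pmf p)", OF _ inj sub])
      (rule measure_pmf.prob_space_axioms)
qed

lemma AE_pullback:
  assumes "lattice_automorphism \<phi>" "AE \<omega> in perc_measure p. Q \<omega>"
  shows "AE \<omega> in perc_measure p. Q (pullback \<phi> \<omega>)"
  using AE_distrD[OF measurable_pullback[OF assms(1)]] assms(2) distr_pullback[OF assms(1)] by metis

lemma measure_pullback:
  assumes \<phi>: "lattice_automorphism \<phi>" and Q: "Measurable.pred (perc_measure p) Q"
  shows "measure (perc_measure p) {\<omega> \<in> space (perc_measure p). Q (pullback \<phi> \<omega>)} =
    measure (perc_measure p) {\<omega> \<in> space (perc_measure p). Q \<omega>}"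
proof -
  note m = measurable_pullback[OF \<phi>, of p]
  have "measure (perc_measure p) {\<omega> \<in> space (perc_measure p). Q \<omega>} =
      measure (distr (perc_measure p) (perc_measure p) (pullback \<phi>)) {\<omega> \<in> space (perc_measure p). Q \<omega>}"
    by (simp add: distr_pullback[OF \<phi>])
  also have "\<dots> = measure (perc_measure p)
      (pullback \<phi> -` {\<omega> \<in> space (perc_measure p). Q \<omega>} \<inter> space (perc_measure p))"
    using Q by (intro measure_distr m) simp
  also have "pullback \<phi> -` {\<omega> \<in> space (perc_measure p). Q \<omega>} \<inter> space (perc_measure p) =
      {\<omega> \<in> space (perc_measure p). Q (pullback \<phi> \<omega>)}"
    using measurable_space[OF m] by auto
  finally show ?thesis by simp
qed

text \<open>
  The state of \<open>e\<close> is independent of all other edges and closed with positive probability. By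
  Fubini, \<open>Q\<close> therefore holds for almost every configuration of the other edges extended by the
  closed \<open>e\<close>.
\<close>
lemma AE_close_edge:
  assumes p: "p < 1" and e: "e \<in> edges_L" and AE: "AE \<omega> in perc_measure p. Q \<omega>"
  shows "AE \<omega> in perc_measure p. Q (close_edges {e} \<omega>)"
proof -
  define B where "B = measure_pmf (bernoulli_pmf p)"
  define I where "I = edges_L - {e}"
  define M' where "M' = Pi\<^sub>M I (\<lambda>_. B)"
  have B: "prob_space B" unfolding B_def by (rule measure_pmf.prob_space_axioms)
  then have M': "prob_space M'" unfolding M'_def by (intro prob_space_PiM)
  have ins: "insert e I = edges_L" using e by (auto simp: I_def)
  have P: "perc_measure p = Pi\<^sub>M edges_L (\<lambda>_. B)"
    by (simp add: perc_measure_def B_def)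
  interpret pair_sigma_finite B M'
    using B M' by (intro pair_sigma_finite.intro prob_space_imp_sigma_finite)
  have meas: "(\<lambda>(x, X). X(e := x)) \<in> measurable (B \<Otimes>\<^sub>M M') (perc_measure p)"
    unfolding P M'_def case_prod_beta
    by (rule measurable_fun_upd[of _ I]) (use ins in auto)
  have "distr (B \<Otimes>\<^sub>M M') (perc_measure p) (\<lambda>(x, X). X(e := x)) = perc_measure p"
    using distr_pair_PiM_eq_PiM[of I "\<lambda>_. B" e] B ins by (simp add: P M'_def)
  then have "AE z in B \<Otimes>\<^sub>M M'. Q (case z of (x, X) \<Rightarrow> X(e := x))"
    using AE_distrD[OF meas] AE by metis
  then have "AE x in B. AE X in M'. Q (X(e := x))"
    using AE_pair by fastforce
  moreover have "False \<in> set_pmf (bernoulli_pmf p)"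
  proof -
    have "pmf (bernoulli_pmf p) False = 1 - min 1 (max 0 p)"
      by (simp add: bernoulli_pmf.rep_eq)
    then show ?thesis using p by (simp add: set_pmf_iff min_def max_def)
  qed
  ultimately have AE': "AE X in M'. Q (X(e := False))"
    unfolding B_def AE_measure_pmf_iff by blast
  have distr_M': "distr (perc_measure p) M' (\<lambda>\<omega>. \<lambda>n\<in>I. \<omega> n) = M'"
    unfolding P M'_def using B
    by (intro distr_PiM_reindex[of edges_L "\<lambda>_. B" "\<lambda>n. n" I]) (auto simp: I_def)
  have meas_M': "(\<lambda>\<omega>. \<lambda>n\<in>I. \<omega> n) \<in> measurable (perc_measure p) M'"
    unfolding P M'_def
    by (intro measurable_restrict measurable_component_singleton) (auto simp: I_def)
  have "AE X in distr (perc_measure p) M' (\<lambda>\<omega>. \<lambda>n\<in>I. \<omega> n). Q (X(e := False))"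
    unfolding distr_M' by (rule AE')
  then have "AE \<omega> in perc_measure p. Q ((\<lambda>n\<in>I. \<omega> n)(e := False))"
    by (rule AE_distrD[OF meas_M'])
  moreover have "(\<lambda>n\<in>I. \<omega> n)(e := False) = close_edges {e} \<omega>" if "\<omega> \<in> space (perc_measure p)" for \<omega>
  proof
    fix n
    have "\<omega> \<in> extensional edges_L"
      using \<open>\<omega> \<in> space (perc_measure p)\<close> by (simp add: P space_PiM PiE_iff)
    then have "\<omega> n = undefined" if "n \<notin> edges_L"
      using that by (rule extensional_arb)
    then show "((\<lambda>n\<in>I. \<omega> n)(e := False)) n = close_edges {e} \<omega> n"
      by (auto simp: I_def close_edges_def)
  qed
  ultimately show ?thesis
    by (auto elim!: AE_mp intro!: AE_I2)
qed

lemma AE_close_edges: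
  assumes p: "p < 1" and A: "finite A" "A \<subseteq> edges_L" and AE: "AE \<omega> in perc_measure p. Q \<omega>"
  shows "AE \<omega> in perc_measure p. Q (close_edges A \<omega>)"
  using A
proof (induction rule: finite_induct)
  case empty
  then show ?case using AE by (simp add: close_edges_def)
next
  case (insert e A)
  then have "AE \<omega> in perc_measure p. Q (close_edges A (close_edges {e} \<omega>))"
    using AE_close_edge[OF p, of e "\<lambda>\<omega>. Q (close_edges A \<omega>)"] by simp
  moreover have "close_edges A (close_edges {e} \<omega>) = close_edges (insert e A) \<omega>" for \<omega>
    by (auto simp: close_edges_def)
  ultimately show ?case by simp
qed

section \<open>Coalescence\<close>

text \<open>
  The left-hand side is the expected number of the events \<open>A j\<close> that occur.
\<close>
lemma (in prob_space) card_mult_prob_le: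
  fixes C :: real
  assumes J: "finite J"
    and A: "\<And>j. j \<in> J \<Longrightarrow> A j \<in> events" "\<And>j. j \<in> J \<Longrightarrow> prob (A j) = \<delta>"
    and C: "AE x in M. real (card {j \<in> J. x \<in> A j}) \<le> C"
  shows "real (card J) * \<delta> \<le> C"
proof -
  have card: "(\<Sum>j\<in>J. indicator (A j) x) = real (card {j \<in> J. x \<in> A j})" for x
    using J by (simp add: indicator_def sum.If_cases Int_def)
  have int: "integrable M (indicator (A j) :: _ \<Rightarrow> real)" if "j \<in> J" for j
    using A(1)[OF that] by (intro integrable_real_indicator) (auto simp: less_top[symmetric])
  have "real (card J) * \<delta> = (\<Sum>j\<in>J. expectation (indicator (A j)))"
    using A by simp
  also have "\<dots> = expectation (\<lambda>x. \<Sum>j\<in>J. indicator (A j) x)"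
    by (intro Bochner_Integration.integral_sum[symmetric] int)
  also have "\<dots> \<le> C"
  proof (rule integral_le_const)
    show "integrable M (\<lambda>x. \<Sum>j\<in>J. indicator (A j) x :: real)"
      by (intro Bochner_Integration.integrable_sum int)
  qed (use C in \<open>simp add: card\<close>)
  finally show ?thesis .
qed

lemma nonneg_eq_0_if_multiples_bounded:
  fixes \<delta> C :: real
  assumes "0 \<le> \<delta>" "\<And>n. 0 < n \<Longrightarrow> real n * \<delta> \<le> C"
  shows "\<delta> = 0"
proof (rule ccontr)
  assume "\<delta> \<noteq> 0"
  then have "0 < \<delta>" using assms(1) by simp
  then obtain n where n: "C < real n * \<delta>" using reals_Archimedean3 by blast
  have "real n * \<delta> \<le> real (Suc n) * \<delta>"
    using \<open>0 < \<delta>\<close> by (intro mult_right_mono) auto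
  then show False using n assms(2)[of "Suc n"] by simp
qed

text \<open>
  The volume-against-boundary count: in a sheared \<open>N\<close> by \<open>N\<close> box of translates of \<open>y\<close>, the disjoint
  rightmost paths of the isolated sources end at distinct vertices among \<open>4 * N + 1\<close> on the top
  level. An average of \<open>N * N * \<delta>\<close> sources is therefore only possible for \<open>\<delta> = 0\<close>.
\<close>
lemma AE_not_isolated_source: "AE \<omega> in perc_measure p. \<not> isolated_source \<omega> y"
proof -
  interpret prob_space "perc_measure p" by (rule prob_space_perc_measure)
  define \<delta> where "\<delta> = prob {\<omega> \<in> space (perc_measure p). isolated_source \<omega> y}"
  \<comment> \<open>The shear by \<open>int j\<close> keeps the translation vectors on the lattice.\<close>
  define t :: "nat \<times> nat \<Rightarrow> vertex" where "t = (\<lambda>(i, j). (2 * int i + int j, int j))"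
  define g where "g = (\<lambda>k. translate (t k) y)"
  have tL: "t k \<in> lattice_L" for k
    by (cases k) (simp add: t_def lattice_L_def)
  have "\<delta> = 0"
  proof (rule nonneg_eq_0_if_multiples_bounded)
    fix N :: nat assume "0 < N"
    let ?J = "{..<N} \<times> {..<N}"
    let ?A = "\<lambda>k. {\<omega> \<in> space (perc_measure p). isolated_source \<omega> (g k)}"
    have "real (card ?J) * \<delta> \<le> real (4 * N + 1)"
    proof (rule card_mult_prob_le[where A = ?A])
      show "prob (?A k) = \<delta>" for k
        using measure_pullback[OF lattice_automorphism_translate[OF tL], of "\<lambda>\<omega>. isolated_source \<omega> y" p k]
        by (simp add: isolated_source_translate[OF tL] g_def \<delta>_def)
      have "card {k \<in> ?J. isolated_source \<omega> (g k)} \<le> 4 * N + 1" for \<omega>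
      proof -
        let ?K = "{k \<in> ?J. isolated_source \<omega> (g k)}"
        \<comment> \<open>All paths are followed up to level \<open>N\<close> above \<open>y\<close>, where they occupy distinct vertices.\<close>
        let ?h = "\<lambda>k. right_path \<omega> (N - snd k) (g k)"
        let ?T = "{fst y - int N..fst y + 3 * int N} \<times> {snd y + int N}"
        have inj: "inj_on ?h ?K"
        proof (rule inj_onI, rule ccontr)
          fix k l assume kl: "k \<in> ?K" "l \<in> ?K" "?h k = ?h l" "k \<noteq> l"
          have "g k \<noteq> g l"
            using kl(4) by (cases k; cases l) (auto simp: g_def t_def translate_def)
          moreover have "snd (g k) + int (N - snd k) = snd (g l) + int (N - snd l)"
            using kl(1,2) by (cases k; cases l) (auto simp: g_def t_def translate_def)
          ultimately show False
            using isolated_source_paths_disjoint kl(1-3) by blast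
        qed
        have "?h ` ?K \<subseteq> ?T"
        proof
          fix v assume "v \<in> ?h ` ?K"
          then obtain i j where ij: "i < N" "j < N" "v = right_path \<omega> (N - j) (g (i, j))" by auto
          have g: "g (i, j) = (fst y + 2 * int i + int j, snd y + int j)"
            by (simp add: g_def t_def translate_def)
          show "v \<in> ?T"
            using fst_right_path[of "N - j" \<omega> "g (i, j)"] snd_right_path[of "N - j" \<omega> "g (i, j)"] ij
            by (auto simp: g mem_Times_iff of_nat_diff)
        qed
        then have "card ?K \<le> card ?T"
          by (rule card_inj_on_le[OF inj]) simp
        also have "card ?T = 4 * N + 1"
          by (simp add: card_cartesian_product)
        finally show ?thesis .
      qed
      then show "AE \<omega> in perc_measure p. real (card {k \<in> ?J. \<omega> \<in> ?A k}) \<le> real (4 * N + 1)"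
        by (intro AE_I2) (simp del: of_nat_add of_nat_Suc add: of_nat_le_iff)
    qed simp_all
    also have "\<dots> \<le> real N * 5" using \<open>0 < N\<close> by simp
    finally have "real N * (real N * \<delta>) \<le> real N * 5"
      by (simp add: card_cartesian_product mult.assoc)
    then show "real N * \<delta> \<le> 5" using \<open>0 < N\<close> by simp
  qed (simp add: \<delta>_def)
  then show ?thesis
    using prob_Collect_eq_0[of "\<lambda>\<omega>. isolated_source \<omega> y"] by (simp add: \<delta>_def)
qed

text \<open>
  Almost surely no isolated source arises by closing some finite set of edges, because there are
  only countably many such sets; a triple without coalescence would give one.
\<close>
lemma AE_no_noncoalescing_triple:
  assumes p: "p < 1"
  shows "AE \<omega> in perc_measure p. \<forall>x\<in>percolation_points \<omega>. \<forall>y\<in>percolation_points \<omega>.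
    \<forall>z\<in>percolation_points \<omega>. snd x = snd y \<longrightarrow> snd z = snd y \<longrightarrow> fst x < fst y \<longrightarrow> fst y < fst z \<longrightarrow>
      coalesce \<omega> x y \<or> coalesce \<omega> y z"
proof -
  have "countable {A. finite A \<and> A \<subseteq> edges_L}"
    by (rule countable_Collect_finite_subset) simp
  then have "AE \<omega> in perc_measure p. \<forall>A\<in>{A. finite A \<and> A \<subseteq> edges_L}. \<forall>y.
      \<not> isolated_source (close_edges A \<omega>) y"
  proof (rule AE_ball_countable[THEN iffD2], intro ballI)
    fix A :: "edge set" assume "A \<in> {A. finite A \<and> A \<subseteq> edges_L}"
    then have A: "finite A" "A \<subseteq> edges_L" by auto
    have "AE \<omega> in perc_measure p. \<forall>y. \<not> isolated_source \<omega> y"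
      by (simp add: AE_all_countable AE_not_isolated_source)
    then show "AE \<omega> in perc_measure p. \<forall>y. \<not> isolated_source (close_edges A \<omega>) y"
      by (rule AE_close_edges[OF p A])
  qed
  then show ?thesis
  proof (rule AE_mp, intro AE_I2 impI ballI)
    fix \<omega> x y z
    assume *: "\<forall>A\<in>{A. finite A \<and> A \<subseteq> edges_L}. \<forall>y. \<not> isolated_source (close_edges A \<omega>) y"
      and **: "x \<in> percolation_points \<omega>" "y \<in> percolation_points \<omega>" "z \<in> percolation_points \<omega>"
        "snd x = snd y" "snd z = snd y" "fst x < fst y" "fst y < fst z"
    show "coalesce \<omega> x y \<or> coalesce \<omega> y z"
    proof (rule ccontr)
      assume "\<not> (coalesce \<omega> x y \<or> coalesce \<omega> y z)"
      then obtain A where "finite A" "A \<subseteq> edges_L" "isolated_source (close_edges A \<omega>) y"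
        using isolated_source_by_closing[OF **] by metis
      then show False using * by blast
    qed
  qed
qed

text \<open>
  The events that the successive horizontal translates of a pair \<open>a\<close>, \<open>b\<close> fail to coalesce are
  equally likely, and almost surely no two of them occur together: by the previous lemma, two
  such translates would make the paths of \<open>?y\<close> and \<open>?z\<close> below coalesce, and with them that of \<open>?a\<close>.
  Arbitrarily many events of the same probability can exclude each other only if it is 0.
\<close>
lemma AE_coalesce:
  assumes p: "p < 1"
  shows "AE \<omega> in perc_measure p. \<forall>a\<in>percolation_points \<omega>. \<forall>b\<in>percolation_points \<omega>.
    snd a = snd b \<longrightarrow> fst a < fst b \<longrightarrow> coalesce \<omega> a b"
proof -
  interpret prob_space "perc_measure p" by (rule prob_space_perc_measure)
  have *: "AE \<omega> in perc_measure p.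
      \<not> (a \<in> percolation_points \<omega> \<and> b \<in> percolation_points \<omega> \<and> \<not> coalesce \<omega> a b)"
    if ab: "snd a = snd b" "fst a < fst b" for a b
  proof -
    define G where "G = (\<lambda>\<omega> t. translate t a \<in> percolation_points \<omega> \<and>
      translate t b \<in> percolation_points \<omega> \<and> \<not> coalesce \<omega> (translate t a) (translate t b))"
    define \<delta> where "\<delta> = prob {\<omega> \<in> space (perc_measure p). G \<omega> (0, 0)}"
    \<comment> \<open>The factor 2 provides the right parity and keeps the translates of \<open>[a, b]\<close> disjoint.\<close>
    define t :: "nat \<Rightarrow> vertex" where "t = (\<lambda>k. (2 * int k * (fst b - fst a), 0))"
    have G_meas [measurable]: "Measurable.pred (perc_measure p) (\<lambda>\<omega>. G \<omega> s)" for s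
      unfolding G_def by measurable
    have tL: "t k \<in> lattice_L" for k
      by (simp add: t_def lattice_L_def)
    have G_translate: "G (pullback (translate (t k)) \<omega>) (0, 0) \<longleftrightarrow> G \<omega> (t k)" for \<omega> k
    proof -
      have "translate (0, 0) u = u" for u by (simp add: translate_def)
      then show ?thesis
        by (simp add: G_def percolation_points_pullback[OF lattice_automorphism_translate[OF tL]]
            coalesce_translate[OF tL])
    qed
    have "\<delta> = 0"
    proof (rule nonneg_eq_0_if_multiples_bounded)
      fix m :: nat
      let ?A = "\<lambda>k. {\<omega> \<in> space (perc_measure p). G \<omega> (t k)}"
      have "real (card {..<m}) * \<delta> \<le> 1"
      proof (rule card_mult_prob_le[where A = ?A])
        show "prob (?A k) = \<delta>" for k
          using measure_pullback[OF lattice_automorphism_translate[OF tL], of "\<lambda>\<omega>. G \<omega> (0, 0)" p k]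
          by (simp add: G_translate \<delta>_def)
        show "AE \<omega> in perc_measure p. real (card {k \<in> {..<m}. \<omega> \<in> ?A k}) \<le> 1"
          using AE_no_noncoalescing_triple[OF p]
        proof (rule AE_mp, intro AE_I2 impI)
          fix \<omega>
          assume triple: "\<forall>x\<in>percolation_points \<omega>. \<forall>y\<in>percolation_points \<omega>.
            \<forall>z\<in>percolation_points \<omega>. snd x = snd y \<longrightarrow> snd z = snd y \<longrightarrow> fst x < fst y \<longrightarrow>
              fst y < fst z \<longrightarrow> coalesce \<omega> x y \<or> coalesce \<omega> y z"
          have no: False if jk: "j < k" and G: "G \<omega> (t j)" "G \<omega> (t k)" for j k
          proof -
            let ?x = "translate (t j) a" and ?y = "translate (t j) b"
            let ?a = "translate (t k) a" and ?z = "translate (t k) b"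
            have "2 * (fst b - fst a) \<le> 2 * int (k - j) * (fst b - fst a)"
              using jk ab(2) by (intro mult_right_mono) auto
            then have le: "fst ?y \<le> fst ?a"
              using jk ab(2) by (simp add: translate_def t_def of_nat_diff algebra_simps)
            have lt: "fst ?x < fst ?y" "fst ?a < fst ?z"
              using ab(2) by (simp_all add: translate_def)
            have level: "snd ?x = snd ?y" "snd ?z = snd ?y" "snd ?a = snd ?y"
              using ab(1) by (simp_all add: translate_def t_def)
            \<comment> \<open>As \<open>?x\<close> and \<open>?y\<close> do not coalesce, \<open>?y\<close> and \<open>?z\<close> must, which traps \<open>?a\<close> in between.\<close>
            have "coalesce \<omega> ?y ?z"
              using triple G lt le level unfolding G_def by fastforce
            then have "coalesce \<omega> ?a ?z"
              using coalesce_between(2)[of ?y ?a ?z \<omega>] G lt le level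
              by (auto simp: G_def percolation_points_def)
            then show False using G(2) by (simp add: G_def)
          qed
          have "card {k \<in> {..<m}. \<omega> \<in> ?A k} \<le> Suc 0"
            using no by (subst card_le_Suc0_iff_eq) (auto, metis linorder_neqE_nat)
          then show "real (card {k \<in> {..<m}. \<omega> \<in> ?A k}) \<le> 1" by linarith
        qed
      qed simp_all
      then show "real m * \<delta> \<le> 1" by simp
    qed (simp add: \<delta>_def)
    then have "AE \<omega> in perc_measure p. \<not> G \<omega> (0, 0)"
      using prob_Collect_eq_0[of "\<lambda>\<omega>. G \<omega> (0, 0)"] by (simp add: \<delta>_def)
    then show ?thesis by (simp add: G_def translate_def)
  qed
  have "AE \<omega> in perc_measure p. \<forall>a b. snd a = snd b \<and> fst a < fst b \<longrightarrow>
      \<not> (a \<in> percolation_points \<omega> \<and> b \<in> percolation_points \<omega> \<and> \<not> coalesce \<omega> a b)"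
    using * by (simp add: AE_all_countable AE_impI)
  then show ?thesis by eventually_elim blast
qed

lemma AE_finite_cluster_diff_left:
  assumes p: "p < 1"
  shows "AE \<omega> in perc_measure p. \<forall>a\<in>percolation_points \<omega>. \<forall>b\<in>percolation_points \<omega>.
    snd a = snd b \<longrightarrow> fst a < fst b \<longrightarrow> finite (cluster \<omega> b - cluster \<omega> a)"
  using AE_coalesce[OF p]
  by (rule AE_mp) (auto intro!: AE_I2 finite_cluster_diff_if_coalesce)

lemma AE_finite_cluster_diff:
  assumes p: "p < 1"
  shows "AE \<omega> in perc_measure p. \<forall>a\<in>percolation_points \<omega>. \<forall>b\<in>percolation_points \<omega>.
    snd a = snd b \<longrightarrow> finite (cluster \<omega> b - cluster \<omega> a)"
proof -
  note refl = lattice_automorphism_reflect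
  have bij: "bij reflect" using refl by (simp add: lattice_automorphism_def)
  show ?thesis
    using AE_finite_cluster_diff_left[OF p] AE_pullback[OF refl AE_finite_cluster_diff_left[OF p]]
  proof eventually_elim
    case (elim \<omega>)
    have rr: "reflect (reflect u) = u" for u by (simp add: reflect_def)
    show ?case
    proof (intro ballI impI)
      fix a b assume ab: "a \<in> percolation_points \<omega>" "b \<in> percolation_points \<omega>" "snd a = snd b"
      consider "fst a < fst b" | "a = b" | "fst b < fst a"
        using ab(3) by (metis linorder_neqE prod_eq_iff)
      then show "finite (cluster \<omega> b - cluster \<omega> a)"
      proof cases
        case 1
        then show ?thesis using elim(1) ab by blast
      next
        case 2
        then show ?thesis by simp
      next
        case 3
        have "reflect a \<in> percolation_points (pullback reflect \<omega>)"
          "reflect b \<in> percolation_points (pullback reflect \<omega>)"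
          using ab by (simp_all add: percolation_points_pullback[OF refl] rr)
        moreover have "snd (reflect a) = snd (reflect b)" "fst (reflect a) < fst (reflect b)"
          using ab(3) 3 by (simp_all add: reflect_def)
        ultimately have "finite (cluster (pullback reflect \<omega>) (reflect b) -
            cluster (pullback reflect \<omega>) (reflect a))"
          using elim(2) by blast
        then have "finite (reflect -` (cluster \<omega> b - cluster \<omega> a))"
          by (simp add: cluster_pullback[OF refl] rr vimage_Diff)
        then show ?thesis by (simp add: finite_vimage_iff[OF bij])
      qed
    qed
  qed
qed

text \<open>
  With \<open>n\<close> at least the levels of \<open>u1\<close> and \<open>u2\<close>, an infinite remainder of the cluster of \<open>u2\<close> is
  inherited by some descendant \<open>b\<close> of \<open>u2\<close> on level \<open>n\<close>, and only grows if the cluster of \<open>u1\<close> is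
  replaced by that of a percolating descendant \<open>a\<close> of \<open>u1\<close> on level \<open>n\<close>.
\<close>
lemma finite_cluster_diff_if_same_level:
  assumes same: "\<forall>a\<in>percolation_points \<omega>. \<forall>b\<in>percolation_points \<omega>.
      snd a = snd b \<longrightarrow> finite (cluster \<omega> b - cluster \<omega> a)"
    and u: "u1 \<in> percolation_points \<omega>" "u2 \<in> percolation_points \<omega>"
  shows "finite (cluster \<omega> u2 - cluster \<omega> u1)"
proof (rule ccontr)
  assume inf: "infinite (cluster \<omega> u2 - cluster \<omega> u1)"
  define n where "n = max (snd u1) (snd u2)"
  have L: "u1 \<in> lattice_L" "u2 \<in> lattice_L" "infinite (cluster \<omega> u1 - {})"
    using u by (auto simp: percolation_points_def)
  obtain a where a: "a \<in> cluster \<omega> u1" "snd a = n" "infinite (cluster \<omega> a - {})"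
    using infinite_cluster_minus_descendant[OF L(1,3), of "nat (n - snd u1)"] by (auto simp: n_def)
  obtain b where b: "b \<in> cluster \<omega> u2" "snd b = n" "infinite (cluster \<omega> b - cluster \<omega> u1)"
    using infinite_cluster_minus_descendant[OF L(2) inf, of "nat (n - snd u2)"] by (auto simp: n_def)
  have "infinite (cluster \<omega> b - cluster \<omega> a)"
    using b(3) cluster_subset[OF a(1)] by (meson Diff_mono finite_subset order_refl)
  moreover have "a \<in> percolation_points \<omega>" "b \<in> percolation_points \<omega>"
    using a b by (auto simp: percolation_points_def cluster_def)
  ultimately show False using same a(2) b(2) by simp
qed

theorem theorem1p4:
  fixes p :: real
  assumes "p_crit < p" and "p < 1"
  shows "AE \<omega> in perc_measure p.
    \<forall>u1 \<in> percolation_points \<omega>. \<forall>u2 \<in> percolation_points \<omega>.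
      cluster \<omega> u1 \<asymp> cluster \<omega> u2"
  using AE_finite_cluster_diff[OF assms(2)]
proof (rule AE_mp, intro AE_I2 impI ballI)
  fix \<omega> u1 u2
  assume "\<forall>a\<in>percolation_points \<omega>. \<forall>b\<in>percolation_points \<omega>.
      snd a = snd b \<longrightarrow> finite (cluster \<omega> b - cluster \<omega> a)"
    and "u1 \<in> percolation_points \<omega>" "u2 \<in> percolation_points \<omega>"
  then show "cluster \<omega> u1 \<asymp> cluster \<omega> u2"
    unfolding almost_equal_def by (simp add: finite_cluster_diff_if_same_level)
qed

end
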